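(* Let $d\in\mathbb{N}$, $m\ge1$, let $\{x_1,\dots,x_m\}\subset\mathbb{S}^d$ be an arbitrary initial set, and suppose that it is extended to a sequence $(x_n)_{n\ge1}$ in $\mathbb{S}^d$ satisfying, for all $n\ge m$, $$\sum_{i=1}^n\|x_{n+1}-x_i\|\ge n\cdot(-\mathcal{I}_{-1,d}).$$ Let $\omega_{N,d}$ denote the set of the first $N$ points of this sequence. Then for any $N\ge m$, $$D_{L^2,\mathrm{cap}}(\omega_{N,d})\le\sqrt{\frac1d\,\frac{\Gamma((d+1)/2)}{\sqrt\pi\,\Gamma(d/2)}}\;(-\mathcal{I}_{-1,d})^{1/2}\left(\frac1N+\frac{m^2-m}{N^2}\right)^{1/2}.$$ Moreover, on $\mathbb{S}^2$ (i.e. when $d=2$), $$D_{L^2,\mathrm{cap}}(\omega_{N,2})\le\frac{\sqrt2}{\sqrt3}\left(\frac1N+\frac{m^2-m}{N^2}\right)^{1/2}.$$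
   Context: $\mathbb{S}^d\subset\mathbb{R}^{d+1}$ is the unit sphere with Euclidean norm $\|\cdot\|$, and $\sigma_d$ is the surface measure normalized by $\sigma_d(\mathbb{S}^d)=1$. $-\mathcal{I}_{-1,d}=\int_{\mathbb{S}^d}\int_{\mathbb{S}^d}\|x-y\|\,d\sigma_d(x)\,d\sigma_d(y)>0$. For $w\in\mathbb{S}^d$ and $t\in(-1,1)$, the spherical cap is $C(w,t)=\{x\in\mathbb{S}^d:\langle w,x\rangle\ge t\}$. The $L^2$-spherical cap discrepancy of $\omega_{N,d}=\{x_1,\dots,x_N\}$ (counted with multiplicity) is the nonnegative number $D_{L^2,\mathrm{cap}}(\omega_{N,d})$ with $$D_{L^2,\mathrm{cap}}^2(\omega_{N,d})=\int_{-1}^1\int_{\mathbb{S}^d}\left|\frac1N\sum_{i=1}^N\chi_{C(w,t)}(x_i)-\sigma_d(C(w,t))\right|^2d\sigma_d(w)\,dt.$$ *)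

theory Defs
  imports "HOL-Analysis.Analysis"
begin

text \<open>
  Throughout, the unit sphere is \<^term>\<open>sphere 0 1 :: (real^'n) set\<close>; for a sphere of dimension
  \<open>d\<close> the index type satisfies \<^prop>\<open>CARD('n) = d + 1\<close>.

  The surface measure is given by polar coordinates: the area of a set \<open>A\<close> on the sphere is
  \<open>d + 1\<close> times the Lebesgue measure of the cone
  \<open>{r *\<^sub>R a | r a. 0 < r \<and> r \<le> 1 \<and> a \<in> A}\<close>,
  and this cone is the preimage of \<open>A\<close> under \<open>x \<mapsto> x / \<parallel>x\<parallel>\<close> in the punctured closed unit ball
  (see \<open>emeasure_surface_measure\<close> below).
\<close>

definition surface_measure :: "(real^'n) measure" where
  "surface_measure =
     scale_measure (of_nat CARD('n))
       (distr (restrict_space lborel (cball 0 1 - {0}))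
              (restrict_space borel (sphere 0 1))
              (\<lambda>x. x /\<^sub>R norm x))"

lemma space_surface_measure [simp]: "space surface_measure = sphere 0 1"
  by (simp add: surface_measure_def space_scale_measure space_restrict_space)

lemma sets_surface_measure [measurable_cong]:
  "sets surface_measure = sets (restrict_space borel (sphere 0 1))"
  by (simp add: surface_measure_def)

lemma radial_projection_measurable:
  "(\<lambda>x::real^'n. x /\<^sub>R norm x)
     \<in> measurable (restrict_space lborel (cball 0 1 - {0})) (restrict_space borel (sphere 0 1))"
proof (rule measurable_restrict_space2)
  show "(\<lambda>x::real^'n. x /\<^sub>R norm x)
          \<in> space (restrict_space lborel (cball 0 1 - {0})) \<rightarrow> sphere 0 1"
    by (auto simp: space_restrict_space)
  show "(\<lambda>x::real^'n. x /\<^sub>R norm x) \<in> borel_measurable (restrict_space lborel (cball 0 1 - {0}))"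
    by (rule measurable_restrict_space1) measurable
qed

lemma radial_projection_vimage:
  fixes A :: "(real^'n) set"
  assumes "A \<subseteq> sphere 0 1"
  shows "(\<lambda>x. x /\<^sub>R norm x) -` A \<inter> (cball 0 1 - {0}) =
         {r *\<^sub>R a | r a. 0 < r \<and> r \<le> 1 \<and> a \<in> A}"
proof (intro equalityI subsetI)
  fix x assume x: "x \<in> (\<lambda>x. x /\<^sub>R norm x) -` A \<inter> (cball 0 1 - {0})"
  then have "x = norm x *\<^sub>R (x /\<^sub>R norm x)" "0 < norm x" "norm x \<le> 1" "x /\<^sub>R norm x \<in> A"
    by auto
  then show "x \<in> {r *\<^sub>R a | r a. 0 < r \<and> r \<le> 1 \<and> a \<in> A}"
    by blast
next
  fix x assume "x \<in> {r *\<^sub>R a | r a. 0 < r \<and> r \<le> 1 \<and> a \<in> A}"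
  then obtain r a where x: "x = r *\<^sub>R a" and r: "0 < r" "r \<le> 1" and a: "a \<in> A"
    by blast
  with assms have "norm a = 1" by auto
  then have "a \<noteq> 0" by auto
  with x r a \<open>norm a = 1\<close>
  show "x \<in> (\<lambda>x. x /\<^sub>R norm x) -` A \<inter> (cball 0 1 - {0})"
    by auto
qed

lemma emeasure_surface_measure:
  fixes A :: "(real^'n) set"
  assumes A: "A \<in> sets borel" "A \<subseteq> sphere 0 1"
  shows "emeasure surface_measure A =
         of_nat CARD('n) * emeasure lborel {r *\<^sub>R a | r a. 0 < r \<and> r \<le> 1 \<and> a \<in> A}"
proof -
  have A': "A \<in> sets (restrict_space borel (sphere 0 1))"
    using A by (auto simp: sets_restrict_space)
  have "emeasure (distr (restrict_space lborel (cball 0 1 - {0})) (restrict_space borel (sphere 0 1))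
          (\<lambda>x. x /\<^sub>R norm x)) A
        = emeasure (restrict_space lborel (cball 0 1 - {0}))
            ((\<lambda>x. x /\<^sub>R norm x) -` A \<inter> (cball 0 1 - {0}))"
    by (subst emeasure_distr[OF radial_projection_measurable A'])
       (simp add: space_restrict_space)
  also have "\<dots> = emeasure lborel ((\<lambda>x. x /\<^sub>R norm x) -` A \<inter> (cball 0 1 - {0}))"
    by (rule emeasure_restrict_space) auto
  finally show ?thesis
    unfolding surface_measure_def by (simp add: radial_projection_vimage[OF A(2)])
qed

lemma emeasure_surface_measure_sphere:
  "emeasure surface_measure (sphere (0::real^'n) 1) =
     ennreal (real CARD('n) * unit_ball_vol (real CARD('n)))"
proof -
  have "{r *\<^sub>R a | r a. 0 < r \<and> r \<le> 1 \<and> a \<in> sphere (0::real^'n) 1} = cball 0 1 - {0}"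
    by (subst radial_projection_vimage[symmetric]) auto
  moreover have "emeasure lborel (cball (0::real^'n) 1 - {0}) = emeasure lborel (cball (0::real^'n) 1)"
    by (subst emeasure_Diff) auto
  ultimately show ?thesis
    by (simp add: emeasure_surface_measure emeasure_cball ennreal_mult'' ennreal_of_nat_eq_real_of_nat)
qed

definition normalized_surface_measure :: "(real^'n) measure" where
  "normalized_surface_measure =
     scale_measure (1 / emeasure surface_measure (sphere (0::real^'n) 1)) surface_measure"

lemma space_normalized_surface_measure [simp]:
  "space normalized_surface_measure = sphere 0 1"
  by (simp add: normalized_surface_measure_def space_scale_measure)

lemma sets_normalized_surface_measure [measurable_cong]:
  "sets normalized_surface_measure = sets (restrict_space borel (sphere 0 1))"
  by (simp add: normalized_surface_measure_def sets_surface_measure)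

lemma emeasure_normalized_surface_measure_sphere:
  "emeasure normalized_surface_measure (sphere (0::real^'n) 1) = 1"
proof -
  have "0 < real CARD('n) * unit_ball_vol (real CARD('n))" by simp
  then have "ennreal (real CARD('n) * unit_ball_vol (real CARD('n))) /
             ennreal (real CARD('n) * unit_ball_vol (real CARD('n))) = 1"
    by (intro ennreal_divide_self) (auto simp only: ennreal_less_top ennreal_eq_0_iff)
  then show ?thesis
    by (simp add: normalized_surface_measure_def emeasure_surface_measure_sphere ennreal_divide_times)
qed

text \<open>
  \<open>mean_distance TYPE('n)\<close> is the number \<open>-\<I>\<^bsub>-1,d\<^esub>\<close> (the negative of the Riesz energy with
  exponent \<open>-1\<close>) on the unit sphere of \<^typ>\<open>real^'n\<close>.
\<close>

definition mean_distance :: "'n::finite itself \<Rightarrow> real" where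
  "mean_distance _ =
     (LINT x|(normalized_surface_measure :: (real^'n) measure).
       LINT y|(normalized_surface_measure :: (real^'n) measure). norm (x - y))"

definition spherical_cap :: "real^'n \<Rightarrow> real \<Rightarrow> (real^'n) set" where
  "spherical_cap w t = {x \<in> sphere 0 1. t \<le> w \<bullet> x}"

text \<open>
  The \<open>L\<^sup>2\<close> spherical cap discrepancy of the points \<open>x 1, \<dots>, x N\<close>, counted with multiplicity.
\<close>

definition cap_discrepancy :: "(nat \<Rightarrow> real^'n) \<Rightarrow> nat \<Rightarrow> real" where
  "cap_discrepancy x N =
     sqrt (LINT t:{-1<..<1}|lborel. LINT w|normalized_surface_measure.
       \<bar>(1 / real N) * (\<Sum>i=1..N. indicator (spherical_cap w t) (x i))
          - measure normalized_surface_measure (spherical_cap w t)\<bar>\<^sup>2)"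

end

theory Submission
  imports Defs
begin

text \<open>
  The squared discrepancy is computed exactly by Stolarsky's invariance principle. Since
  \<open>\<integral> 1[t \<le> w \<bullet> x] 1[t \<le> w \<bullet> y] dt = 1 + min (w \<bullet> x) (w \<bullet> y)\<close> over \<open>-1 < t < 1\<close>, averaging over \<open>w\<close> and using
  \<open>min a b = (a + b - \<bar>a - b\<bar>) / 2\<close> gives the kernel \<open>1 - \<kappa> \<parallel>x - y\<parallel>\<close>, where by rotation
  invariance \<open>2 \<kappa>\<close> is the mean of \<open>\<bar>w \<bullet> e\<bar>\<close> for a unit vector \<open>e\<close>. Expanding the square yields
  \<open>D\<^sup>2 = \<kappa> (V - N\<^sup>-\<^sup>2 \<Sum>\<^sub>i\<^sub>,\<^sub>j \<parallel>x\<^sub>i - x\<^sub>j\<parallel>)\<close> with \<open>V\<close> the mean distance. Summing the greedy condition bounds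
  the double sum below by \<open>V (N\<^sup>2 - N - m\<^sup>2 + m)\<close>. For \<open>d = 2\<close> one has \<open>\<kappa> = 1/4\<close>, and \<open>V \<le> 2\<close> suffices.
\<close>

section \<open>Rotation invariance\<close>

lemma nn_integral_lborel_translate:
  fixes f :: "'a::euclidean_space \<Rightarrow> ennreal"
  assumes [measurable]: "f \<in> borel_measurable borel"
  shows "(\<integral>\<^sup>+x. f (x + a) \<partial>lborel) = (\<integral>\<^sup>+x. f x \<partial>lborel)"
proof -
  have "(\<integral>\<^sup>+x. f x \<partial>lborel) = (\<integral>\<^sup>+x. f x \<partial>distr lborel borel ((+) a))"
    by (simp add: lborel_distr_plus)
  also have "\<dots> = (\<integral>\<^sup>+x. f (x + a) \<partial>lborel)"
    by (subst nn_integral_distr) (auto simp: add.commute)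
  finally show ?thesis ..
qed

text \<open>
  The image measure \<open>M\<close> is translation invariant, and uniqueness of Haar measure is obtained by
  evaluating \<open>\<integral>\<integral> 1\<^sub>A(x) 1\<^sub>B(y - x) dM(x) dy\<close> in both orders, with \<open>B\<close> the unit ball, on which both
  measures agree.
\<close>

lemma distr_lborel_orthogonal_transformation:
  fixes T :: "'a::euclidean_space \<Rightarrow> 'a"
  assumes T: "orthogonal_transformation T"
  shows "distr lborel borel T = lborel"
proof (rule measure_eqI)
  let ?M = "distr lborel borel T"
  have [measurable]: "T \<in> borel_measurable borel"
    by (intro borel_measurable_continuous_onI linear_continuous_on
        linear_linear[THEN iffD2] orthogonal_transformation_linear[OF T])
  have ball: "T -` ball 0 1 = ball 0 1"
    using T by (auto simp: orthogonal_transformation_norm)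
  have [measurable]: "ball (0::'a) 1 \<in> sets borel"
    by simp
  have emb: "emeasure ?M (ball 0 1) = emeasure lborel (ball 0 1 :: 'a set)"
    by (subst emeasure_distr) (auto simp: ball)
  have M: "(\<integral>\<^sup>+x. f x \<partial>?M) = (\<integral>\<^sup>+x. f (T x) \<partial>lborel)" if [measurable]: "f \<in> borel_measurable borel" for f
    by (subst nn_integral_distr) auto
  have M_translate: "(\<integral>\<^sup>+x. f (x + a) \<partial>?M) = (\<integral>\<^sup>+x. f x \<partial>?M)"
    if [measurable]: "f \<in> borel_measurable borel" for f a
  proof -
    \<comment> \<open>Surjectivity of \<open>T\<close> turns a shift by \<open>a\<close> after
      \<open>T\<close> into a shift by \<open>b\<close> before it, where the translation invariance
      of \<open>lborel\<close> applies.\<close>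
    obtain b where b: "a = T b"
      using orthogonal_transformation_surj[OF T] by (metis surjD)
    have "(\<integral>\<^sup>+x. f (T x + a) \<partial>lborel) = (\<integral>\<^sup>+x. f (T (x + b)) \<partial>lborel)"
      by (simp add: b linear_add[OF orthogonal_transformation_linear[OF T]])
    also have "\<dots> = (\<integral>\<^sup>+x. f (T x) \<partial>lborel)"
      by (rule nn_integral_lborel_translate[of "\<lambda>x. f (T x)"]) measurable
    finally show ?thesis by (simp add: M)
  qed
  \<comment> \<open>Exchanging the integrals requires \<open>?M\<close> to be sigma-finite. Balls
    about the origin exhaust the space and equal their own preimages under \<open>T\<close>, so they
    have finite measure.\<close>
  have "sigma_finite_measure ?M"
  proof
    show "\<exists>A. countable A \<and> A \<subseteq> sets ?M \<and> \<Union>A = space ?M \<and> (\<forall>a\<in>A. emeasure ?M a \<noteq> \<infinity>)"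
    proof (intro exI[of _ "range (\<lambda>n::nat. ball 0 (real n))"] conjI ballI)
      show "\<Union> (range (\<lambda>n::nat. ball (0::'a) (real n))) = space ?M"
        using reals_Archimedean2 by auto
      fix a assume "a \<in> range (\<lambda>n::nat. ball (0::'a) (real n))"
      then obtain n where a: "a = ball 0 (real n)" by auto
      have "T -` a = a"
        using T by (auto simp: orthogonal_transformation_norm a)
      moreover have "emeasure lborel a \<noteq> \<infinity>"
        by (simp add: a emeasure_ball)
      ultimately show "emeasure ?M a \<noteq> \<infinity>"
        by (subst emeasure_distr) (auto simp: a)
    qed auto
  qed
  then interpret M: sigma_finite_measure ?M .
  interpret P: pair_sigma_finite ?M "lborel :: 'a measure" ..
  fix A assume "A \<in> sets ?M"
  then have A[measurable]: "A \<in> sets borel" by simp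
  let ?a = "indicator A :: 'a \<Rightarrow> ennreal" and ?b = "indicator (ball 0 1) :: 'a \<Rightarrow> ennreal"
  have "emeasure ?M A * emeasure lborel (ball 0 1 :: 'a set)
      = (\<integral>\<^sup>+x. ?a x * (\<integral>\<^sup>+y. ?b y \<partial>lborel) \<partial>?M)"
    by (subst nn_integral_multc) auto
  also have "\<dots> = (\<integral>\<^sup>+x. (\<integral>\<^sup>+y. ?a x * ?b (y + - x) \<partial>lborel) \<partial>?M)"
  proof (rule nn_integral_cong)
    fix x
    have "(\<integral>\<^sup>+y. ?a x * ?b (y + - x) \<partial>lborel) = ?a x * (\<integral>\<^sup>+y. ?b (y + - x) \<partial>lborel)"
      by (rule nn_integral_cmult) measurable
    then show "?a x * (\<integral>\<^sup>+y. ?b y \<partial>lborel) = (\<integral>\<^sup>+y. ?a x * ?b (y + - x) \<partial>lborel)"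
      by (subst (asm) nn_integral_lborel_translate) auto
  qed
  also have "\<dots> = (\<integral>\<^sup>+y. (\<integral>\<^sup>+x. ?a x * ?b (y + - x) \<partial>?M) \<partial>lborel)"
    by (rule P.Fubini'[symmetric]) measurable
  \<comment> \<open>Shifting \<open>x\<close> by \<open>y\<close>, which \<open>?M\<close> does not
    notice, leaves \<open>?b (- x)\<close>; the symmetry of the ball then turns this into
    \<open>?b x\<close>.\<close>
  also have "\<dots> = (\<integral>\<^sup>+y. (\<integral>\<^sup>+x. ?a (x + y) * ?b (y + - (x + y)) \<partial>?M) \<partial>lborel)"
    by (subst M_translate[where f = "\<lambda>x. ?a x * ?b (_ + - x)"]) auto
  also have "\<dots> = (\<integral>\<^sup>+y. (\<integral>\<^sup>+x. ?a (y + x) * ?b x \<partial>?M) \<partial>lborel)"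
    by (auto simp: indicator_def add.commute intro!: nn_integral_cong)
  also have "\<dots> = (\<integral>\<^sup>+x. (\<integral>\<^sup>+y. ?a (y + x) * ?b x \<partial>lborel) \<partial>?M)"
    by (rule P.Fubini') measurable
  also have "\<dots> = (\<integral>\<^sup>+x. emeasure lborel A * ?b x \<partial>?M)"
  proof (rule nn_integral_cong)
    fix x
    have "(\<integral>\<^sup>+y. ?a (y + x) * ?b x \<partial>lborel) = (\<integral>\<^sup>+y. ?a (y + x) \<partial>lborel) * ?b x"
      by (rule nn_integral_multc) measurable
    then show "(\<integral>\<^sup>+y. ?a (y + x) * ?b x \<partial>lborel) = emeasure lborel A * ?b x"
      by (subst (asm) nn_integral_lborel_translate) auto
  qed
  also have "\<dots> = emeasure lborel A * emeasure lborel (ball 0 1 :: 'a set)"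
    by (subst nn_integral_cmult) (auto simp: emb)
  finally have "emeasure ?M A * emeasure lborel (ball 0 1 :: 'a set)
              = emeasure lborel A * emeasure lborel (ball 0 1 :: 'a set)" .
  moreover have "emeasure lborel (ball 0 1 :: 'a set) \<noteq> 0" "emeasure lborel (ball 0 1 :: 'a set) \<noteq> \<infinity>"
    using unit_ball_vol_pos[of "real DIM('a)"] by (auto simp: emeasure_ball simp del: unit_ball_vol_pos)
  ultimately show "emeasure ?M A = emeasure lborel A"
    by (subst (asm) (1 2) mult.commute) (auto simp: ennreal_mult_cancel_left)
qed simp

section \<open>The normalized surface measure in terms of Lebesgue measure on the ball\<close>

lemma finite_measure_normalized_surface_measure:
  "finite_measure (normalized_surface_measure :: (real^'n) measure)"
  by (rule finite_measureI) (simp add: emeasure_normalized_surface_measure_sphere)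

lemma measure_normalized_surface_measure_sphere [simp]:
  "measure (normalized_surface_measure :: (real^'n) measure) (sphere 0 1) = 1"
  by (simp add: measure_def emeasure_normalized_surface_measure_sphere)

text \<open>The total area is \<open>CARD('n)\<close> times the volume of the ball, so the factor
  \<open>CARD('n)\<close> of the cone construction cancels. What remains is the law of the direction
  of a uniformly distributed point of the ball.\<close>

lemma normalized_surface_measure_eq_scale:
  "(normalized_surface_measure :: (real^'n) measure) =
     scale_measure (1 / ennreal (unit_ball_vol (real CARD('n))))
       (distr (restrict_space lborel (cball 0 1 - {0}))
              (restrict_space borel (sphere 0 1))
              (\<lambda>x. x /\<^sub>R norm x))"
proof -
  define c where "c = real CARD('n)"
  define v where "v = unit_ball_vol c"
  have "0 < c" "0 < v"
    by (auto simp: c_def v_def)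
  have "1 / ennreal (c * v) * ennreal c = ennreal (1 / (c * v)) * ennreal c"
    using divide_ennreal[of 1 "c * v"] \<open>0 < c\<close> \<open>0 < v\<close> by simp
  also have "\<dots> = ennreal (1 / v)"
    using \<open>0 < c\<close> \<open>0 < v\<close> by (simp flip: ennreal_mult)
  also have "\<dots> = 1 / ennreal v"
    using divide_ennreal[of 1 v] \<open>0 < v\<close> by simp
  finally have "1 / ennreal (real CARD('n) * unit_ball_vol (real CARD('n))) * of_nat CARD('n)
      = 1 / ennreal (unit_ball_vol (real CARD('n)))"
    by (simp add: c_def v_def ennreal_of_nat_eq_real_of_nat)
  then show ?thesis
    unfolding normalized_surface_measure_def emeasure_surface_measure_sphere
    unfolding surface_measure_def by (simp only: scale_scale_measure)
qed

text \<open>Integrals over the sphere become Lebesgue integrals of functions of the direction alone.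
  The origin is a null set, so the full closed ball may replace the punctured one.\<close>

lemma nn_integral_normalized_surface_measure:
  fixes g :: "real^'n \<Rightarrow> ennreal"
  assumes [measurable]: "g \<in> borel_measurable borel"
  shows "(\<integral>\<^sup>+x. g x \<partial>normalized_surface_measure) =
     1 / ennreal (unit_ball_vol (real CARD('n))) *
       (\<integral>\<^sup>+x. g (x /\<^sub>R norm x) * indicator (cball 0 1) x \<partial>lborel)"
proof -
  have g: "g \<in> borel_measurable (restrict_space borel (sphere 0 1))"
    by (rule measurable_restrict_space1) simp
  have "(\<integral>\<^sup>+x. g x \<partial>normalized_surface_measure) =
     1 / ennreal (unit_ball_vol (real CARD('n))) *
       (\<integral>\<^sup>+x. g (x /\<^sub>R norm x) \<partial>restrict_space lborel (cball 0 1 - {0}))"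
    unfolding normalized_surface_measure_eq_scale
    using g by (subst nn_integral_scale_measure)
      (auto simp: nn_integral_distr[OF radial_projection_measurable])
  also have "(\<integral>\<^sup>+x. g (x /\<^sub>R norm x) \<partial>restrict_space lborel (cball 0 1 - {0}))
      = (\<integral>\<^sup>+x. g (x /\<^sub>R norm x) * indicator (cball 0 1 - {0}) x \<partial>lborel)"
    by (rule nn_integral_restrict_space) auto
  also have "\<dots> = (\<integral>\<^sup>+x. g (x /\<^sub>R norm x) * indicator (cball 0 1) x \<partial>lborel)"
    by (intro nn_integral_cong_AE AE_I[of _ _ "{0}"]) (auto simp: indicator_def)
  finally show ?thesis .
qed

text \<open>Being linear and norm-preserving, \<open>T\<close> commutes with the radial projection
  and preserves the ball, so the invariance descends from \<open>lborel\<close>.\<close>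

lemma distr_normalized_surface_measure_orthogonal:
  fixes T :: "real^'n \<Rightarrow> real^'n"
  assumes T: "orthogonal_transformation T"
  shows "distr normalized_surface_measure normalized_surface_measure T = normalized_surface_measure"
    and "T \<in> measurable normalized_surface_measure normalized_surface_measure"
proof -
  have [measurable]: "T \<in> borel_measurable borel"
    by (intro borel_measurable_continuous_onI linear_continuous_on
        linear_linear[THEN iffD2] orthogonal_transformation_linear[OF T])
  have "T \<in> measurable (restrict_space borel (sphere 0 1)) (restrict_space borel (sphere 0 1))"
    using orthogonal_transformation_norm[OF T]
    by (intro measurable_restrict_space3) auto
  then show meas: "T \<in> measurable normalized_surface_measure normalized_surface_measure"
    by (subst measurable_cong_sets[OF sets_normalized_surface_measure sets_normalized_surface_measure])
  show "distr normalized_surface_measure normalized_surface_measure T = normalized_surface_measure"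
    (is "?D = ?\<sigma>")
  proof (rule measure_eqI)
    fix A assume "A \<in> sets ?D"
    then have "A \<in> sets (restrict_space borel (sphere (0::real^'n) 1))"
      by (simp add: sets_normalized_surface_measure)
    then have A[measurable]: "A \<in> sets borel"
      using sets_restrict_space_subset[of "sphere (0::real^'n) 1" borel] by (auto simp: sets_restrict_space)
    have A': "A \<in> sets ?\<sigma>"
      using \<open>A \<in> sets ?D\<close> by simp
    have [measurable]: "cball (0::real^'n) 1 \<in> sets borel"
      by simp
    let ?F = "\<lambda>x. indicator A (x /\<^sub>R norm x) * indicator (cball 0 1) x :: ennreal"
    have "emeasure ?D A = (\<integral>\<^sup>+x. indicator A x \<partial>?D)"
      using A' by simp
    also have "\<dots> = (\<integral>\<^sup>+x. indicator A (T x) \<partial>?\<sigma>)"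
      using A' by (subst nn_integral_distr[OF meas]) auto
    also have "\<dots> = 1 / ennreal (unit_ball_vol (real CARD('n))) *
        (\<integral>\<^sup>+x. indicator A (T (x /\<^sub>R norm x)) * indicator (cball 0 1) x \<partial>lborel)"
      by (rule nn_integral_normalized_surface_measure) measurable
    also have "(\<lambda>x. indicator A (T (x /\<^sub>R norm x)) * indicator (cball 0 1) x) = (\<lambda>x. ?F (T x))"
      using orthogonal_transformation_norm[OF T] orthogonal_transformation_linear[OF T]
      by (auto simp: fun_eq_iff linear_cmul indicator_def)
    also have "(\<integral>\<^sup>+x. ?F (T x) \<partial>lborel) = (\<integral>\<^sup>+x. ?F x \<partial>distr lborel borel T)"
      by (rule nn_integral_distr[symmetric]) measurable
    also have "1 / ennreal (unit_ball_vol (real CARD('n))) * \<dots> = (\<integral>\<^sup>+x. indicator A x \<partial>?\<sigma>)"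
      unfolding distr_lborel_orthogonal_transformation[OF T]
      by (rule nn_integral_normalized_surface_measure[symmetric]) measurable
    also have "\<dots> = emeasure ?\<sigma> A"
      using A' by simp
    finally show "emeasure ?D A = emeasure ?\<sigma> A" .
  qed simp
qed

section \<open>The mean of a linear functional in absolute value\<close>

text \<open>The substitution of \<open>s *\<^sub>R x\<close> for \<open>x\<close> leaves
  \<open>f\<close> unchanged, maps the unit ball onto the ball of radius \<open>s\<close> and
  contributes the Jacobian \<open>s ^ DIM('a)\<close>.\<close>

lemma nn_integral_homogeneous_cball:
  fixes f :: "'a::euclidean_space \<Rightarrow> ennreal"
  assumes [measurable]: "f \<in> borel_measurable borel"
    and f: "\<And>s x. 0 < s \<Longrightarrow> f (s *\<^sub>R x) = f x" and "0 < s"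
  shows "(\<integral>\<^sup>+x. f x * indicator (cball 0 s) x \<partial>lborel) =
    ennreal (s ^ DIM('a)) * (\<integral>\<^sup>+x. f x * indicator (cball 0 1) x \<partial>lborel)"
proof -
  have [measurable]: "cball (0::'a) r \<in> sets borel" for r
    by simp
  have "(\<integral>\<^sup>+x. f x * indicator (cball 0 s) x \<partial>lborel)
      = (\<integral>\<^sup>+x. f x * indicator (cball 0 s) x
           \<partial>density (distr lborel borel (\<lambda>x. 0 + s *\<^sub>R x)) (\<lambda>_. \<bar>s\<bar> ^ DIM('a)))"
    using lborel_affine[of s "0::'a"] \<open>0 < s\<close> by simp
  also have "\<dots> = (\<integral>\<^sup>+x. ennreal (s ^ DIM('a)) * (f (s *\<^sub>R x) * indicator (cball 0 s) (s *\<^sub>R x)) \<partial>lborel)"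
    using \<open>0 < s\<close> by (subst nn_integral_density, measurable, subst nn_integral_distr) (auto simp: abs_of_pos)
  also have "\<dots> = (\<integral>\<^sup>+x. ennreal (s ^ DIM('a)) * (f x * indicator (cball 0 1) x) \<partial>lborel)"
    using \<open>0 < s\<close> by (auto simp: f indicator_def intro!: nn_integral_cong)
  also have "\<dots> = ennreal (s ^ DIM('a)) * (\<integral>\<^sup>+x. f x * indicator (cball 0 1) x \<partial>lborel)"
    by (rule nn_integral_cmult) measurable
  finally show ?thesis .
qed

text \<open>Writing \<open>1 - norm x\<close> as the length of \<open>{norm x..1}\<close> and exchanging the integrals
  expresses the weight \<open>norm x\<close> through the integrals over the balls of radius \<open>s \<le> 1\<close>.\<close>

lemma nn_integral_homogeneous_norm_cball:
  fixes f :: "'a::euclidean_space \<Rightarrow> ennreal"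
  assumes [measurable]: "f \<in> borel_measurable borel"
    and f: "\<And>s x. 0 < s \<Longrightarrow> f (s *\<^sub>R x) = f x"
    and h: "(\<integral>\<^sup>+x. f x * ennreal (norm x) * indicator (cball 0 1) x \<partial>lborel) = ennreal h"
    and fin: "(\<integral>\<^sup>+x. f x * indicator (cball 0 1) x \<partial>lborel) \<noteq> \<infinity>" and "0 \<le> h"
  shows "(\<integral>\<^sup>+x. f x * indicator (cball 0 1) x \<partial>lborel) = ennreal ((real DIM('a) + 1) / real DIM('a) * h)"
proof -
  let ?n = "DIM('a)"
  have [measurable]: "cball (0::'a) r \<in> sets borel" for r
    by simp
  obtain g where G: "(\<integral>\<^sup>+x. f x * indicator (cball 0 1) x \<partial>lborel) = ennreal g" and "0 \<le> g"
    using fin by (metis ennreal_cases infinity_ennreal_def)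
  have pow: "(\<integral>\<^sup>+s. ennreal (s ^ ?n) * indicator {0..1} s \<partial>lborel) = ennreal (1 / (real ?n + 1))"
  proof -
    have "((\<lambda>s. s ^ (?n + 1) / (real ?n + 1)) has_real_derivative s ^ ?n) (at s)" for s :: real
      by (rule DERIV_cong[OF DERIV_cdivide[OF DERIV_pow[of "?n + 1"]]]) (simp add: field_simps)
    then show ?thesis
      using nn_integral_FTC_Icc[of "\<lambda>s. s ^ ?n" 0 1 "\<lambda>s. s ^ (?n + 1) / (real ?n + 1)"] by simp
  qed
  have "(\<integral>\<^sup>+x. f x * ennreal (1 - norm x) * indicator (cball 0 1) x \<partial>lborel)
      = (\<integral>\<^sup>+x. (\<integral>\<^sup>+s. (if norm x \<le> s \<and> s \<le> 1 then f x else 0) \<partial>lborel) \<partial>(lborel :: 'a measure))"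
  proof (rule nn_integral_cong)
    fix x :: 'a
    have "(\<integral>\<^sup>+s. (if norm x \<le> s \<and> s \<le> 1 then f x else 0) \<partial>lborel)
        = (\<integral>\<^sup>+s. f x * indicator {norm x..1} s \<partial>lborel)"
      by (auto simp: indicator_def intro!: nn_integral_cong)
    also have "\<dots> = f x * emeasure lborel {norm x..1}"
      by (rule nn_integral_cmult_indicator) auto
    finally show "f x * ennreal (1 - norm x) * indicator (cball 0 1) x
        = (\<integral>\<^sup>+s. (if norm x \<le> s \<and> s \<le> 1 then f x else 0) \<partial>lborel)"
      by (cases "norm x \<le> 1") auto
  qed
  also have "\<dots> = (\<integral>\<^sup>+s. (\<integral>\<^sup>+x. (if norm x \<le> s \<and> s \<le> 1 then f x else 0) \<partial>(lborel :: 'a measure)) \<partial>lborel)"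
    by (rule lborel_pair.Fubini') measurable
  also have "\<dots> = (\<integral>\<^sup>+s. ennreal (s ^ ?n) * indicator {0..1} s * ennreal g \<partial>lborel)"
  \<comment> \<open>The radius \<open>s = 0\<close> is dropped as a null set, since the scaling
    identity is stated for positive radii.\<close>
  proof (intro nn_integral_cong_AE AE_I[of _ _ "{0}"])
    show "{s \<in> space lborel. (\<integral>\<^sup>+x. (if norm x \<le> s \<and> s \<le> 1 then f x else 0) \<partial>lborel)
        \<noteq> ennreal (s ^ ?n) * indicator {0..1} s * ennreal g} \<subseteq> {0}"
    proof (intro subsetI, rule ccontr)
      fix s :: real
      assume s: "s \<in> {s \<in> space lborel. (\<integral>\<^sup>+x. (if norm x \<le> s \<and> s \<le> 1 then f x else 0) \<partial>lborel)
        \<noteq> ennreal (s ^ ?n) * indicator {0..1} s * ennreal g}" and "s \<notin> {0}"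
      consider "s < 0" | "0 < s" "s \<le> 1" | "1 < s"
        using \<open>s \<notin> {0}\<close> by fastforce
      then have "(\<integral>\<^sup>+x. (if norm x \<le> s \<and> s \<le> 1 then f x else 0) \<partial>lborel)
        = ennreal (s ^ ?n) * indicator {0..1} s * ennreal g"
      proof cases
        case 1
        then have "\<not> norm x \<le> s" for x :: 'a
          using norm_ge_zero[of x] by linarith
        with 1 show ?thesis by simp
      next
        case 2
        then have "(\<integral>\<^sup>+x. (if norm x \<le> s \<and> s \<le> 1 then f x else 0) \<partial>lborel)
          = (\<integral>\<^sup>+x. f x * indicator (cball 0 s) x \<partial>lborel)"
          by (auto simp: indicator_def intro!: nn_integral_cong)
        also have "\<dots> = ennreal (s ^ ?n) * ennreal g"
          unfolding G[symmetric] using \<open>0 < s\<close> by (intro nn_integral_homogeneous_cball f) auto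
        finally show ?thesis using 2 by simp
      qed auto
      with s show False by simp
    qed
  qed auto
  also have "\<dots> = ennreal (1 / (real ?n + 1)) * ennreal g"
    unfolding pow[symmetric] by (rule nn_integral_multc) measurable
  also have "\<dots> = ennreal (g / (real ?n + 1))"
    using \<open>0 \<le> g\<close> by (simp flip: ennreal_mult)
  finally have *: "(\<integral>\<^sup>+x. f x * ennreal (1 - norm x) * indicator (cball 0 1) x \<partial>lborel)
      = ennreal (g / (real ?n + 1))" .
  \<comment> \<open>The weights \<open>1 - norm x\<close> and \<open>norm x\<close> add up to 1 on
    the ball, whence \<open>g = g / (n + 1) + h\<close> for the dimension \<open>n\<close>. As
    \<open>g\<close> is finite, this can be solved for \<open>g\<close>.\<close>
  have "ennreal g = (\<integral>\<^sup>+x. f x * ennreal (1 - norm x) * indicator (cball 0 1) x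
        + f x * ennreal (norm x) * indicator (cball 0 1) x \<partial>lborel)"
    unfolding G[symmetric]
    by (auto simp: indicator_def distrib_left[symmetric] ennreal_plus[symmetric] simp del: ennreal_plus
        intro!: nn_integral_cong)
  also have "\<dots> = ennreal (g / (real ?n + 1)) + ennreal h"
    by (subst nn_integral_add) (auto simp: * h)
  also have "\<dots> = ennreal (g / (real ?n + 1) + h)"
    using \<open>0 \<le> g\<close> \<open>0 \<le> h\<close> by simp
  finally have "g = g / (real ?n + 1) + h"
    using \<open>0 \<le> g\<close> \<open>0 \<le> h\<close> by (subst (asm) ennreal_inj) auto
  then have "g = (real ?n + 1) / real ?n * h"
    using DIM_positive[where 'a='a] by (simp add: field_simps)
  with G show ?thesis by simp
qed

text \<open>On \<open>{0..1}\<close> the integrand has the antiderivative \<open>?F\<close>, and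
  evenness doubles the result. It is the height profile that arises when a ball is cut into
  slices.\<close>

lemma nn_integral_abs_mult_sqrt_power:
  "(\<integral>\<^sup>+t. ennreal (\<bar>t\<bar> * sqrt (1 - t\<^sup>2) ^ k) * indicator {-1..1} t \<partial>lborel) = ennreal (2 / (real k + 2))"
proof -
  let ?f = "\<lambda>t::real. \<bar>t\<bar> * sqrt (1 - t\<^sup>2) ^ k"
  let ?F = "\<lambda>t::real. - (sqrt (1 - t\<^sup>2) ^ (k + 2)) / (real k + 2)"
  have "(?f has_integral (?F 1 - ?F 0)) {0..1}"
  \<comment> \<open>The interior form only asks for continuity at the endpoints; at
    \<open>t = 1\<close> the inner square root is not differentiable.\<close>
  proof (rule fundamental_theorem_of_calculus_interior)
    show "continuous_on {0..1} ?F"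
      by (intro continuous_intros) auto
    fix t :: real assume t: "t \<in> {0<..<1}"
    then have pos: "0 < 1 - t\<^sup>2"
      by (simp add: power_less_one_iff abs_square_less_1)
    have "((\<lambda>t. sqrt (1 - t\<^sup>2)) has_real_derivative - t / sqrt (1 - t\<^sup>2)) (at t)"
      using pos by (auto intro!: derivative_eq_intros simp: divide_simps)
    from DERIV_cdivide[OF DERIV_minus[OF DERIV_power[OF this, of "k + 2"]], of "real k + 2"]
    have "(?F has_real_derivative t / sqrt (1 - t\<^sup>2) * sqrt (1 - t\<^sup>2) ^ (k + 1)) (at t)"
      by (simp add: add.commute)
    also have "t / sqrt (1 - t\<^sup>2) * sqrt (1 - t\<^sup>2) ^ (k + 1) = ?f t"
      using pos t by simp
    finally show "(?F has_vector_derivative ?f t) (at t)"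
      by (simp add: has_real_derivative_iff_has_vector_derivative)
  qed auto
  then have 1: "(?f has_integral 1 / (real k + 2)) {0..1}"
    by simp
  then have 2: "(?f has_integral 1 / (real k + 2)) {-1..0}"
    using has_integral_reflect_real[where f = ?f and a = 0 and b = 1] by simp
  have "(?f has_integral 1 / (real k + 2) + 1 / (real k + 2)) {-1..1}"
    by (rule has_integral_combine[OF _ _ 2 1]) auto
  then have I: "(?f has_integral 2 / (real k + 2)) {-1..1}"
    by simp
  let ?g = "\<lambda>t::real. ?f t * indicator {-1..1} t"
  have "?g = (\<lambda>t. if t \<in> {-1..1} then ?f t else 0)"
    by (auto simp: fun_eq_iff indicator_def)
  with I have "(?g has_integral 2 / (real k + 2)) UNIV"
    by (simp only: has_integral_restrict_UNIV)
  then have "(\<integral>\<^sup>+t. ennreal (?g t) \<partial>lborel) = ennreal (2 / (real k + 2))"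
    by (intro nn_integral_has_integral_lborel) (auto simp: indicator_def abs_square_le_1)
  then show ?thesis
    by (simp add: ennreal_mult'' ennreal_indicator)
qed

text \<open>Cavalieri's principle along \<open>e\<close>: the slice of the ball at height
  \<open>t\<close> is a ball of radius \<open>sqrt (1 - t\<^sup>2)\<close> in one dimension less,
  and the remaining integral over \<open>t\<close> is the one just computed.\<close>

lemma nn_integral_abs_inner_cball:
  fixes e :: "'a::euclidean_space"
  assumes e: "e \<in> Basis"
  shows "(\<integral>\<^sup>+x. ennreal \<bar>x \<bullet> e\<bar> * indicator (cball 0 1) x \<partial>lborel) =
    ennreal (2 * unit_ball_vol (real (DIM('a) - 1)) / (real DIM('a) + 1))"
proof -
  let ?A = "Basis - {e}" and ?d = "DIM('a) - 1"
  interpret product_sigma_finite "\<lambda>_::'a. lborel :: real measure"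
    by standard
  have [measurable]: "cball (0::'a) 1 \<in> sets borel"
    by simp
  have card: "card ?A = ?d"
    using e by simp
  have "(\<integral>\<^sup>+x. ennreal \<bar>x \<bullet> e\<bar> * indicator (cball 0 1) x \<partial>lborel) =
    (\<integral>\<^sup>+f. ennreal \<bar>(\<Sum>b\<in>Basis. f b *\<^sub>R b) \<bullet> e\<bar> * indicator (cball 0 1) (\<Sum>b\<in>Basis. f b *\<^sub>R b)
      \<partial>(\<Pi>\<^sub>M b\<in>Basis. lborel))"
    by (subst lborel_eq, subst nn_integral_distr) auto
  also have "\<dots> = (\<integral>\<^sup>+f. (if sqrt ((f e)\<^sup>2 + (\<Sum>b\<in>?A. (f b)\<^sup>2)) \<le> 1 then ennreal \<bar>f e\<bar> else 0)
      \<partial>(\<Pi>\<^sub>M b\<in>insert e ?A. lborel))"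
  proof -
    have "norm (\<Sum>b\<in>Basis. f b *\<^sub>R b) = sqrt ((f e)\<^sup>2 + (\<Sum>b\<in>?A. (f b)\<^sup>2))" for f :: "'a \<Rightarrow> real"
    proof -
      have "norm (\<Sum>b\<in>Basis. f b *\<^sub>R b) = sqrt (\<Sum>b\<in>Basis. (f b)\<^sup>2)"
        using euclidean_dist_l2[of "\<Sum>b\<in>Basis. f b *\<^sub>R b" 0] by (simp add: L2_set_def)
      also have "(\<Sum>b\<in>Basis. (f b)\<^sup>2) = (f e)\<^sup>2 + (\<Sum>b\<in>?A. (f b)\<^sup>2)"
        using e by (simp add: sum.remove)
      finally show ?thesis .
    qed
    moreover have "(\<Sum>b\<in>Basis. f b *\<^sub>R b) \<bullet> e = f e" for f :: "'a \<Rightarrow> real"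
      using e by simp
    ultimately show ?thesis
      using e by (auto simp: insert_absorb indicator_def intro!: nn_integral_cong)
  qed
  also have "\<dots> = (\<integral>\<^sup>+t. \<integral>\<^sup>+f. (if sqrt (t\<^sup>2 + (\<Sum>b\<in>?A. (f b)\<^sup>2)) \<le> 1 then ennreal \<bar>t\<bar> else 0)
      \<partial>(\<Pi>\<^sub>M b\<in>?A. lborel) \<partial>lborel)"
    by (subst product_nn_integral_insert_rev) (auto intro!: nn_integral_cong sum.cong arg_cong[where f=sqrt])
  also have "\<dots> = (\<integral>\<^sup>+t. ennreal (\<bar>t\<bar> * sqrt (1 - t\<^sup>2) ^ ?d) * indicator {-1..1} t *
      ennreal (unit_ball_vol (real ?d)) \<partial>lborel)"
  \<comment> \<open>At heights -1 and 1 the slice has radius zero. Discarding them leaves balls of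
    positive radius for \<open>\<bar>t\<bar> < 1\<close> and empty slices beyond.\<close>
  proof (intro nn_integral_cong_AE AE_I[of _ _ "{-1, 1}"])
    show "{t \<in> space lborel. (\<integral>\<^sup>+f. (if sqrt (t\<^sup>2 + (\<Sum>b\<in>?A. (f b)\<^sup>2)) \<le> 1 then ennreal \<bar>t\<bar> else 0)
        \<partial>(\<Pi>\<^sub>M b\<in>?A. lborel)) \<noteq> ennreal (\<bar>t\<bar> * sqrt (1 - t\<^sup>2) ^ ?d) * indicator {-1..1} t *
        ennreal (unit_ball_vol (real ?d))} \<subseteq> {-1, 1}"
    proof (intro subsetI, rule ccontr)
      fix t :: real
      let ?L = "\<integral>\<^sup>+f. (if sqrt (t\<^sup>2 + (\<Sum>b\<in>?A. (f b)\<^sup>2)) \<le> 1 then ennreal \<bar>t\<bar> else 0) \<partial>(\<Pi>\<^sub>M b\<in>?A. lborel)"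
      let ?R = "ennreal (\<bar>t\<bar> * sqrt (1 - t\<^sup>2) ^ ?d) * indicator {-1..1} t * ennreal (unit_ball_vol (real ?d))"
      assume t: "t \<in> {t \<in> space lborel. (\<integral>\<^sup>+f. (if sqrt (t\<^sup>2 + (\<Sum>b\<in>?A. (f b)\<^sup>2)) \<le> 1 then ennreal \<bar>t\<bar> else 0)
        \<partial>(\<Pi>\<^sub>M b\<in>?A. lborel)) \<noteq> ennreal (\<bar>t\<bar> * sqrt (1 - t\<^sup>2) ^ ?d) * indicator {-1..1} t *
        ennreal (unit_ball_vol (real ?d))}" "t \<notin> {-1, 1}"
      have "?L = ?R"
      proof (cases "\<bar>t\<bar> < 1")
        case True
        then have pos: "0 < 1 - t\<^sup>2"
          by (simp add: abs_square_less_1)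
        let ?S = "{f. sqrt (\<Sum>b\<in>?A. (f b)\<^sup>2) \<le> sqrt (1 - t\<^sup>2)} \<inter> space (\<Pi>\<^sub>M b\<in>?A. (lborel::real measure))"
        have "?L = (\<integral>\<^sup>+f. ennreal \<bar>t\<bar> * indicator ?S f \<partial>(\<Pi>\<^sub>M b\<in>?A. lborel))"
          by (intro nn_integral_cong) (auto simp: indicator_def)
        also have "\<dots> = ennreal \<bar>t\<bar> * emeasure (\<Pi>\<^sub>M b\<in>?A. lborel) ?S"
          by (rule nn_integral_cmult_indicator) measurable
        also have "\<dots> = ennreal \<bar>t\<bar> * ennreal (unit_ball_vol (real ?d) * sqrt (1 - t\<^sup>2) ^ ?d)"
          using pos by (subst emeasure_cball_aux) (auto simp: card)
        also have "\<dots> = ?R"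
        proof -
          have "indicator {-1..1} t = (1::ennreal)"
            using True by (auto simp: indicator_def)
          then show ?thesis
            using pos by (simp add: mult_ac flip: ennreal_mult)
        qed
        finally show ?thesis .
      next
        case False
        then have "1 < \<bar>t\<bar>"
          using t(2) by auto
        then have "1 < t\<^sup>2"
          by (metis abs_square_less_1 abs_square_eq_1 linorder_less_linear order.asym)
        have "\<not> t\<^sup>2 + (\<Sum>b\<in>?A. (f b)\<^sup>2) \<le> 1" for f
          using \<open>1 < t\<^sup>2\<close> sum_nonneg[of ?A "\<lambda>b. (f b)\<^sup>2"] by (smt (verit) zero_le_power2)
        then have "?L = 0"
          by simp
        moreover have "?R = 0"
          using \<open>1 < \<bar>t\<bar>\<close> by (auto simp: indicator_def)
        ultimately show ?thesis by simp
      qed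
      with t show False by simp
    qed
  qed (auto simp: emeasure_lborel_countable)
  also have "\<dots> = ennreal (2 / (real ?d + 2)) * ennreal (unit_ball_vol (real ?d))"
    unfolding nn_integral_abs_mult_sqrt_power[symmetric] by (rule nn_integral_multc) measurable
  also have "\<dots> = ennreal (2 * unit_ball_vol (real ?d) / (real ?d + 2))"
    by (simp flip: ennreal_mult)
  also have "real ?d + 2 = real DIM('a) + 1"
    using DIM_positive[where 'a='a] by (simp add: of_nat_diff)
  finally show ?thesis .
qed

text \<open>The function \<open>?f\<close> depends on the direction only, and multiplied by
  \<open>norm x\<close> it becomes \<open>\<bar>x \<bullet> e\<bar>\<close>, whose ball integral is
  known. Removing the weight \<open>norm x\<close> costs the factor \<open>(n + 1) / n\<close> with
  \<open>n = CARD('n)\<close>.\<close>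

lemma nn_integral_abs_inner_sphere:
  fixes e :: "real^'n"
  assumes e: "e \<in> Basis"
  shows "(\<integral>\<^sup>+w. ennreal \<bar>w \<bullet> e\<bar> \<partial>normalized_surface_measure) =
    ennreal (2 * unit_ball_vol (real (CARD('n) - 1)) / (real CARD('n) * unit_ball_vol (real CARD('n))))"
proof -
  let ?n = "CARD('n)"
  let ?f = "\<lambda>x::real^'n. ennreal \<bar>(x /\<^sub>R norm x) \<bullet> e\<bar>"
  have [measurable]: "cball (0::real^'n) 1 \<in> sets borel"
    by simp
  have "(\<integral>\<^sup>+x. ?f x * indicator (cball 0 1) x \<partial>lborel) \<le> (\<integral>\<^sup>+x. indicator (cball (0::real^'n) 1) x \<partial>lborel)"
  proof (rule nn_integral_mono)
    fix x :: "real^'n"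
    have "\<bar>(x /\<^sub>R norm x) \<bullet> e\<bar> \<le> norm (x /\<^sub>R norm x) * norm e"
      by (rule Cauchy_Schwarz_ineq2)
    also have "\<dots> \<le> 1"
      using e by (cases "x = 0") auto
    finally show "?f x * indicator (cball 0 1) x \<le> indicator (cball 0 1) x"
      by (auto simp: indicator_def)
  qed
  also have "\<dots> < \<infinity>"
    by (simp add: emeasure_cball)
  finally have fin: "(\<integral>\<^sup>+x. ?f x * indicator (cball 0 1) x \<partial>lborel) \<noteq> \<infinity>"
    by simp
  have "(\<integral>\<^sup>+x. ?f x * ennreal (norm x) * indicator (cball 0 1) x \<partial>lborel)
      = (\<integral>\<^sup>+x. ennreal \<bar>x \<bullet> e\<bar> * indicator (cball 0 1) x \<partial>lborel)"
  proof (rule nn_integral_cong)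
    fix x :: "real^'n"
    have "?f x * ennreal (norm x) = ennreal \<bar>x \<bullet> e\<bar>"
      by (cases "x = 0") (auto simp: abs_mult simp flip: ennreal_mult)
    then show "?f x * ennreal (norm x) * indicator (cball 0 1) x = ennreal \<bar>x \<bullet> e\<bar> * indicator (cball 0 1) x"
      by simp
  qed
  then have "(\<integral>\<^sup>+x. ?f x * ennreal (norm x) * indicator (cball 0 1) x \<partial>lborel)
      = ennreal (2 * unit_ball_vol (real (?n - 1)) / (real ?n + 1))"
    using nn_integral_abs_inner_cball[OF e] by simp
  moreover have "?f (s *\<^sub>R x) = ?f x" if "0 < s" for s :: real and x
    using that by (cases "x = 0") (auto simp: divide_simps)
  ultimately have "(\<integral>\<^sup>+x. ?f x * indicator (cball 0 1) x \<partial>lborel)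
      = ennreal ((real DIM(real^'n) + 1) / real DIM(real^'n) *
          (2 * unit_ball_vol (real (?n - 1)) / (real ?n + 1)))"
    by (intro nn_integral_homogeneous_norm_cball fin) auto
  then have "(\<integral>\<^sup>+w. ennreal \<bar>w \<bullet> e\<bar> \<partial>normalized_surface_measure) =
      1 / ennreal (unit_ball_vol (real ?n)) *
      ennreal ((real ?n + 1) / real ?n * (2 * unit_ball_vol (real (?n - 1)) / (real ?n + 1)))"
    by (subst nn_integral_normalized_surface_measure) simp_all
  also have "1 / ennreal (unit_ball_vol (real ?n)) = ennreal (1 / unit_ball_vol (real ?n))"
    using divide_ennreal[of 1 "unit_ball_vol (real ?n)"] by simp
  finally show ?thesis
    by (simp flip: ennreal_mult)
qed

text \<open>For \<open>CARD('n) = d + 1\<close> the left side is the mean of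
  \<open>\<bar>w \<bullet> e\<bar>\<close>, and the right side is twice the Gamma quotient of the
  final bound. The functional equation of Gamma links the two.\<close>

lemma unit_ball_vol_ratio_Gamma:
  assumes "d \<ge> 1"
  shows "2 * unit_ball_vol (real d) / (real (d + 1) * unit_ball_vol (real (d + 1)))
       = 2 * (1 / real d * (Gamma ((real d + 1) / 2) / (sqrt pi * Gamma (real d / 2))))"
proof -
  have 1: "Gamma (real d / 2 + 1) = real d / 2 * Gamma (real d / 2)"
    using assms by (intro Gamma_plus1) (auto simp: nonpos_Ints_def)
  have 2: "Gamma (real (d + 1) / 2 + 1) = real (d + 1) / 2 * Gamma (real (d + 1) / 2)"
    by (intro Gamma_plus1) (auto elim!: nonpos_Ints_cases)
  have 3: "pi powr (real (d + 1) / 2) = pi powr (real d / 2) * sqrt pi"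
    by (simp add: powr_add add_divide_distrib powr_half_sqrt)
  have pos: "0 < Gamma (real d / 2)" "0 < Gamma (real (d + 1) / 2)" "0 < pi powr (real d / 2)"
    using assms by (auto intro!: Gamma_real_pos)
  show ?thesis
    unfolding unit_ball_vol_def 1 2 3 using pos assms by (simp add: divide_simps add.commute)
qed

section \<open>Integrals over the sphere evaluated by rotation invariance\<close>

abbreviation \<sigma> :: "(real^'n) measure" where
  "\<sigma> \<equiv> normalized_surface_measure"

lemma borel_measurable_normalized_surface_measure [measurable (raw)]:
  "f \<in> measurable borel M \<Longrightarrow> f \<in> measurable \<sigma> M"
  by (subst measurable_cong_sets[OF sets_normalized_surface_measure refl])
    (rule measurable_restrict_space1)

lemma integral_const_normalized_surface_measure:
  "(\<And>x. x \<in> sphere 0 1 \<Longrightarrow> f x = c) \<Longrightarrow> (LINT x|(\<sigma> :: (real^'n) measure). f x) = (c::real)"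
  by (subst Bochner_Integration.integral_cong[where g = "\<lambda>_. c"]) auto

lemma integrable_normalized_surface_measure:
  fixes f :: "real^'n \<Rightarrow> real"
  assumes [measurable]: "f \<in> borel_measurable borel"
    and "\<And>x. x \<in> sphere 0 1 \<Longrightarrow> \<bar>f x\<bar> \<le> B"
  shows "integrable \<sigma> f"
  using assms(2)
  by (intro finite_measure.integrable_const_bound[OF finite_measure_normalized_surface_measure, where B = B])
    auto

lemma integral_orthogonal_transformation_sphere:
  fixes f :: "real^'n \<Rightarrow> real" and T :: "real^'n \<Rightarrow> real^'n"
  assumes T: "orthogonal_transformation T" and [measurable]: "f \<in> borel_measurable borel"
  shows "(LINT w|\<sigma>. f (T w)) = (LINT w|\<sigma>. f w)"
proof -
  have "(LINT w|\<sigma>. f (T w)) = (LINT w|distr \<sigma> \<sigma> T. f w)"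
    by (rule integral_distr[symmetric, OF distr_normalized_surface_measure_orthogonal(2)[OF T]]) measurable
  then show ?thesis
    by (simp add: distr_normalized_surface_measure_orthogonal(1)[OF T])
qed

text \<open>The reflection of \<open>w\<close> to \<open>- w\<close> is orthogonal, so the integral
  equals its own negative.\<close>

lemma integral_inner_sphere: "(LINT w|\<sigma>. w \<bullet> x) = 0"
proof -
  have "orthogonal_transformation (\<lambda>w::real^'n. - w)"
    by (simp add: orthogonal_transformation_neg orthogonal_transformation_id)
  from integral_orthogonal_transformation_sphere[OF this, of "\<lambda>w. w \<bullet> x"]
  show ?thesis by simp
qed

text \<open>An orthogonal map carrying \<open>norm v *\<^sub>R e\<close> to \<open>v\<close> reduces
  the claim to a basis vector \<open>e\<close>, with \<open>norm v\<close> pulled out as a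
  factor.\<close>

lemma integral_abs_inner_sphere:
  fixes v :: "real^'n"
  shows "(LINT w|\<sigma>. \<bar>w \<bullet> v\<bar>) =
    norm v * (2 * unit_ball_vol (real (CARD('n) - 1)) / (real CARD('n) * unit_ball_vol (real CARD('n))))"
proof -
  define E where "E = 2 * unit_ball_vol (real (CARD('n) - 1)) / (real CARD('n) * unit_ball_vol (real CARD('n)))"
  have "0 \<le> E" by (simp add: E_def)
  obtain e :: "real^'n" where e: "e \<in> Basis"
    using nonempty_Basis by blast
  have E: "(LINT w|\<sigma>. \<bar>w \<bullet> e\<bar>) = E"
    using nn_integral_abs_inner_sphere[OF e] \<open>0 \<le> E\<close> unfolding E_def[symmetric]
    by (subst integral_eq_nn_integral) auto
  have "norm (norm v *\<^sub>R e) = norm v"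
    using e by simp
  then obtain T where T: "orthogonal_transformation T" "T (norm v *\<^sub>R e) = v"
    using orthogonal_transformation_exists by metis
  have "(LINT w|\<sigma>. \<bar>w \<bullet> v\<bar>) = (LINT w|\<sigma>. \<bar>T w \<bullet> v\<bar>)"
    by (rule integral_orthogonal_transformation_sphere[OF T(1), symmetric]) measurable
  also have "\<dots> = (LINT w|\<sigma>. norm v * \<bar>w \<bullet> e\<bar>)"
  proof -
    have "T w \<bullet> T (norm v *\<^sub>R e) = w \<bullet> (norm v *\<^sub>R e)" for w
      using T(1) by (simp only: orthogonal_transformation_def)
    then have "T w \<bullet> v = norm v * (w \<bullet> e)" for w
      by (simp only: T(2) inner_scaleR_right)
    then show ?thesis by (simp add: abs_mult)
  qed
  also have "\<dots> = norm v * E"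
    by (simp add: E)
  finally show ?thesis by (simp add: E_def)
qed

text \<open>A rotation moves any point of the sphere to any other, so the inner integral of
  \<open>mean_distance\<close> is constant and the outer average returns this constant.\<close>

lemma integral_distance_sphere:
  fixes x :: "real^'n"
  assumes x: "x \<in> sphere 0 1"
  shows "(LINT y|\<sigma>. norm (x - y)) = mean_distance TYPE('n)"
proof -
  have "(LINT y|\<sigma>. norm (z - y)) = (LINT y|\<sigma>. norm (x - y))" if z: "z \<in> sphere 0 1" for z :: "real^'n"
  proof -
    have "norm x = norm z"
      using x z by simp
    then obtain T where T: "orthogonal_transformation T" "T x = z"
      by (rule orthogonal_transformation_exists)
    have "(LINT y|\<sigma>. norm (z - y)) = (LINT y|\<sigma>. norm (z - T y))"
      by (rule integral_orthogonal_transformation_sphere[OF T(1), symmetric]) measurable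
    also have "\<dots> = (LINT y|\<sigma>. norm (x - y))"
      using T by (metis orthogonal_transformation_norm orthogonal_transformation_linear linear_diff)
    finally show ?thesis .
  qed
  then show ?thesis
    unfolding mean_distance_def by (subst integral_const_normalized_surface_measure) auto
qed

lemma mean_distance_le: "mean_distance TYPE('n::finite) \<le> 2"
proof -
  obtain e :: "real^'n" where "e \<in> Basis"
    using nonempty_Basis by blast
  then have e: "e \<in> sphere 0 1"
    by simp
  have le: "norm (e - y) \<le> 2" if "y \<in> sphere 0 1" for y
    using e that norm_triangle_ineq4[of e y] by simp
  have "(LINT y|\<sigma>. norm (e - y)) \<le> (LINT y|(\<sigma> :: (real^'n) measure). 2)"
    using le by (intro integral_mono integrable_normalized_surface_measure[where B = 2]) auto
  then show ?thesis
    by (simp add: integral_distance_sphere[OF e])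
qed

section \<open>Stolarsky's invariance principle\<close>

text \<open>Pairs \<open>(t, w)\<close> parametrise the caps \<open>C(w, t)\<close>.\<close>

definition cap_parameter_measure :: "(real \<times> (real^'n)) measure" where
  "cap_parameter_measure = restrict_space lborel {-1<..<1} \<Otimes>\<^sub>M \<sigma>"

text \<open>The condition \<open>y \<in> sphere 0 1\<close> of \<open>spherical_cap\<close> is left
  out: what remains is a half-space test that is Borel jointly in level, centre and point, and it
  agrees with the cap at points of the sphere.\<close>

definition cap_ind :: "real^'n \<Rightarrow> real \<times> (real^'n) \<Rightarrow> real" where
  "cap_ind y p = (if fst p \<le> snd p \<bullet> y then 1 else 0)"

lemma abs_cap_ind_le: "\<bar>cap_ind y p\<bar> \<le> 1"
  by (simp add: cap_ind_def)

lemma indicator_spherical_cap: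
  "y \<in> sphere 0 1 \<Longrightarrow> indicator (spherical_cap w t) y = cap_ind y (t, w)"
  by (simp add: spherical_cap_def cap_ind_def indicator_def)

lemma finite_measure_cap_level: "finite_measure (restrict_space lborel {-1<..<1::real})"
  by (rule finite_measureI) (simp add: emeasure_restrict_space space_restrict_space)

lemma finite_measure_cap_parameter: "finite_measure (cap_parameter_measure :: (real \<times> (real^'n)) measure)"
  unfolding cap_parameter_measure_def
  by (rule finite_measure_pair_measure[OF finite_measure_normalized_surface_measure finite_measure_cap_level])

lemma measurable_cap_parameter:
  assumes "f \<in> measurable (borel \<Otimes>\<^sub>M borel) M"
  shows "f \<in> measurable cap_parameter_measure M"
proof -
  have "(\<lambda>p. (fst p, snd p)) \<in> measurable (cap_parameter_measure :: (real \<times> (real^'n)) measure) (borel \<Otimes>\<^sub>M borel)"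
    unfolding cap_parameter_measure_def
    by (intro measurable_Pair measurable_compose[OF measurable_fst] measurable_compose[OF measurable_snd]
        borel_measurable_normalized_surface_measure measurable_restrict_space1) auto
  from measurable_compose[OF this assms] show ?thesis by simp
qed

lemma borel_measurable_cap_ind:
  "cap_ind y \<in> borel_measurable cap_parameter_measure"
  unfolding cap_ind_def[abs_def] by (rule measurable_cap_parameter) measurable

text \<open>Joint measurability in cap and point is what allows integrals over caps and over points
  to be exchanged.\<close>

lemma borel_measurable_cap_ind_pair:
  "(\<lambda>q. cap_ind (snd q) (fst q)) \<in> borel_measurable ((cap_parameter_measure :: (real \<times> (real^'n)) measure) \<Otimes>\<^sub>M \<sigma>)"
proof -
  have 1: "(\<lambda>q. (fst q, snd q)) \<in> measurable ((cap_parameter_measure :: (real \<times> (real^'n)) measure) \<Otimes>\<^sub>M \<sigma>)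
      ((borel \<Otimes>\<^sub>M borel) \<Otimes>\<^sub>M borel)"
    by (intro measurable_Pair measurable_compose[OF measurable_fst] measurable_compose[OF measurable_snd]
        borel_measurable_normalized_surface_measure measurable_cap_parameter) auto
  have 2: "(\<lambda>q. cap_ind (snd q) (fst q)) \<in> borel_measurable ((borel \<Otimes>\<^sub>M borel) \<Otimes>\<^sub>M (borel :: (real^'n) measure))"
    unfolding cap_ind_def by measurable
  from measurable_compose[OF 1 2] show ?thesis
    by simp
qed

text \<open>With the integral over \<open>t\<close> taken first, both caps contain their points
  exactly when \<open>t\<close> is at most the smaller inner product \<open>c\<close>, which gives
  the length \<open>c + 1\<close>.\<close>

lemma integral_cap_ind_mult:
  fixes x y :: "real^'n"
  assumes x: "x \<in> sphere 0 1" and y: "y \<in> sphere 0 1"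
  shows "(LINT p|cap_parameter_measure. cap_ind x p * cap_ind y p) =
    1 - norm (x - y) * (unit_ball_vol (real (CARD('n) - 1)) / (real CARD('n) * unit_ball_vol (real CARD('n))))"
proof -
  let ?I = "restrict_space lborel {-1<..<1::real}"
  interpret I: finite_measure ?I by (rule finite_measure_cap_level)
  interpret S: finite_measure "\<sigma> :: (real^'n) measure" by (rule finite_measure_normalized_surface_measure)
  interpret P: pair_sigma_finite ?I "\<sigma> :: (real^'n) measure" ..
  have bound: "\<bar>w \<bullet> z\<bar> \<le> 1" if "w \<in> sphere 0 1" "z \<in> sphere 0 1" for w z :: "real^'n"
    using Cauchy_Schwarz_ineq2[of w z] that by simp
  have "integrable cap_parameter_measure (\<lambda>p. cap_ind x p * cap_ind y p)"
    by (rule finite_measure.integrable_const_bound[OF finite_measure_cap_parameter, where B = 1])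
      (auto simp: cap_ind_def[of _ "(_, _)"] abs_mult intro!: borel_measurable_times borel_measurable_cap_ind mult_le_one abs_cap_ind_le)
  then have int: "integrable (?I \<Otimes>\<^sub>M \<sigma>) (case_prod (\<lambda>t w. cap_ind x (t, w) * cap_ind y (t, w)))"
    by (simp add: cap_parameter_measure_def case_prod_unfold)
  have "(LINT p|cap_parameter_measure. cap_ind x p * cap_ind y p)
      = (LINT w|\<sigma>. LINT t|?I. cap_ind x (t, w) * cap_ind y (t, w))"
    using P.integral_snd[OF int] by (simp add: cap_parameter_measure_def case_prod_unfold)
  also have "\<dots> = (LINT w|\<sigma>. 1 + (w \<bullet> x) / 2 + (w \<bullet> y) / 2 - \<bar>w \<bullet> (x - y)\<bar> / 2)"
  proof (rule Bochner_Integration.integral_cong[OF refl])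
    fix w :: "real^'n" assume "w \<in> space \<sigma>"
    then have w: "w \<in> sphere 0 1" by simp
    define c where "c = min (w \<bullet> x) (w \<bullet> y)"
    have c: "-1 \<le> c" "c \<le> 1"
      using bound[OF w x] bound[OF w y] by (auto simp: c_def)
    have "(LINT t|?I. cap_ind x (t, w) * cap_ind y (t, w)) = (LINT t|?I. indicator {..c} t)"
      by (intro Bochner_Integration.integral_cong) (auto simp: cap_ind_def c_def indicator_def)
    also have "\<dots> = measure ?I ({..c} \<inter> {-1<..<1})"
      by (simp add: space_restrict_space)
    also have "\<dots> = measure lborel ({..c} \<inter> {-1<..<1})"
      by (rule measure_restrict_space) auto
    \<comment> \<open>The case \<open>c = 1\<close> stands apart because the interval of levels is
      open at 1, so there the intersection is not \<open>{-1<..c}\<close>.\<close>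
    also have "\<dots> = c + 1"
    proof (cases "c = 1")
      case True
      then have "{..c} \<inter> {-1<..<1} = {-1<..<1}" by auto
      with True show ?thesis by simp
    next
      case False
      with c have "{..c} \<inter> {-1<..<1} = {-1<..c}" by auto
      with c show ?thesis by simp
    qed
    \<comment> \<open>This writes the minimum as half of sum minus absolute difference. The two
      linear terms then average to zero over \<open>w\<close>.\<close>
    also have "\<dots> = 1 + (w \<bullet> x) / 2 + (w \<bullet> y) / 2 - \<bar>w \<bullet> (x - y)\<bar> / 2"
      by (simp add: c_def min_def inner_diff_right abs_if field_simps)
    finally show "(LINT t|?I. cap_ind x (t, w) * cap_ind y (t, w))
        = 1 + (w \<bullet> x) / 2 + (w \<bullet> y) / 2 - \<bar>w \<bullet> (x - y)\<bar> / 2" .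
  qed
  also have "\<dots> = 1 - (LINT w|\<sigma>. \<bar>w \<bullet> (x - y)\<bar>) / 2"
  proof -
    have "\<bar>w \<bullet> z\<bar> \<le> norm z" if "w \<in> sphere 0 1" for w z :: "real^'n"
      using Cauchy_Schwarz_ineq2[of w z] that by simp
    then have "integrable \<sigma> (\<lambda>w. w \<bullet> z)" for z :: "real^'n"
      by (intro integrable_normalized_surface_measure[where B = "norm z"]) simp_all
    then show ?thesis
      by (simp add: integral_inner_sphere)
  qed
  finally show ?thesis
    by (simp add: integral_abs_inner_sphere)
qed

text \<open>Fubini for a bounded factor \<open>g\<close>. The generality in \<open>g\<close> covers
  both a single cap indicator and the averaged indicator, hence the mixed and the squared terms of
  the expansion.\<close>

lemma integral_cap_average:
  fixes g :: "real \<times> (real^'n) \<Rightarrow> real"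
  assumes [measurable]: "g \<in> borel_measurable cap_parameter_measure" and g: "\<And>p. \<bar>g p\<bar> \<le> 1"
  shows "(LINT p|cap_parameter_measure. g p * (LINT y|\<sigma>. cap_ind y p)) =
    (LINT y|\<sigma>. LINT p|cap_parameter_measure. g p * cap_ind y p)"
proof -
  let ?Q = "cap_parameter_measure :: (real \<times> (real^'n)) measure"
  interpret Q: finite_measure ?Q by (rule finite_measure_cap_parameter)
  interpret S: finite_measure "\<sigma> :: (real^'n) measure" by (rule finite_measure_normalized_surface_measure)
  interpret P: pair_sigma_finite ?Q "\<sigma> :: (real^'n) measure" ..
  note [measurable] = borel_measurable_cap_ind_pair
  have "integrable (?Q \<Otimes>\<^sub>M \<sigma>) (\<lambda>q. g (fst q) * cap_ind (snd q) (fst q))"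
    by (rule finite_measure.integrable_const_bound[where B = 1],
        rule finite_measure_pair_measure[OF finite_measure_normalized_surface_measure finite_measure_cap_parameter],
        rule AE_I2)
      (simp_all add: abs_mult mult_le_one g abs_cap_ind_le)
  then have "integrable (?Q \<Otimes>\<^sub>M \<sigma>) (case_prod (\<lambda>p y. g p * cap_ind y p))"
    by (simp add: case_prod_unfold)
  from P.Fubini_integral[OF this] show ?thesis by simp
qed

text \<open>The integrand is the square of an empirical mean minus \<open>B\<close>. Its three kinds
  of products (\<open>ij\<close>, \<open>iB\<close>, \<open>BB\<close>) all integrate to the kernel
  \<open>1 - \<kappa> * norm (y - z)\<close> or to averages of it.\<close>

lemma stolarsky_invariance:
  fixes x :: "nat \<Rightarrow> real^'n"
  assumes x: "\<And>i. i \<ge> 1 \<Longrightarrow> x i \<in> sphere 0 1" and "N \<ge> 1"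
  shows "cap_discrepancy x N = sqrt (
    unit_ball_vol (real (CARD('n) - 1)) / (real CARD('n) * unit_ball_vol (real CARD('n))) *
    (mean_distance TYPE('n) - (\<Sum>i=1..N. \<Sum>j=1..N. norm (x i - x j)) / (real N)\<^sup>2))"
proof -
  define \<kappa> where "\<kappa> = unit_ball_vol (real (CARD('n) - 1)) / (real CARD('n) * unit_ball_vol (real CARD('n)))"
  define V where "V = mean_distance TYPE('n)"
  let ?Q = "cap_parameter_measure :: (real \<times> (real^'n)) measure"
  let ?I = "restrict_space lborel {-1<..<1::real}"
  interpret I: finite_measure ?I by (rule finite_measure_cap_level)
  interpret S: finite_measure "\<sigma> :: (real^'n) measure" by (rule finite_measure_normalized_surface_measure)
  interpret P: pair_sigma_finite ?I "\<sigma> :: (real^'n) measure" ..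
  define B where "B p = (LINT y|\<sigma>. cap_ind y p)" for p :: "real \<times> (real^'n)"
  note [measurable] = borel_measurable_cap_ind borel_measurable_cap_ind_pair
  have B_meas [measurable]: "B \<in> borel_measurable ?Q"
    unfolding B_def by (rule S.borel_measurable_lebesgue_integral) (simp add: case_prod_beta)
  have B_le: "\<bar>B p\<bar> \<le> 1" for p
  proof -
    have "\<bar>B p\<bar> \<le> (LINT y|(\<sigma> :: (real^'n) measure). 1)"
      unfolding B_def
      by (rule integral_abs_bound[THEN order_trans], rule integral_mono')
         (auto simp: abs_cap_ind_le)
    then show ?thesis by simp
  qed
  have integrable: "integrable ?Q (\<lambda>p. f p * g p)"
    if [measurable]: "f \<in> borel_measurable ?Q" "g \<in> borel_measurable ?Q"
      and "\<And>p. \<bar>f p\<bar> \<le> 1" "\<And>p. \<bar>g p\<bar> \<le> 1" for f g :: "real \<times> (real^'n) \<Rightarrow> real"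
    by (rule finite_measure.integrable_const_bound[OF finite_measure_cap_parameter, where B = 1], rule AE_I2)
      (simp_all add: abs_mult mult_le_one that(3,4))
  have ij: "(LINT p|?Q. cap_ind y p * cap_ind z p) = 1 - norm (y - z) * \<kappa>"
    if "y \<in> sphere 0 1" "z \<in> sphere 0 1" for y z
    using integral_cap_ind_mult[OF that] by (simp add: \<kappa>_def)
  \<comment> \<open>Replacing one point by an average over the sphere replaces its distance in the
    kernel by the mean distance \<open>V\<close>.\<close>
  have iB: "(LINT p|?Q. cap_ind y p * B p) = 1 - V * \<kappa>" if y: "y \<in> sphere 0 1" for y
  proof -
    have "(LINT p|?Q. cap_ind y p * B p) = (LINT z|\<sigma>. LINT p|?Q. cap_ind y p * cap_ind z p)"
      unfolding B_def by (rule integral_cap_average) (auto simp: abs_cap_ind_le)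
    also have "\<dots> = (LINT z|\<sigma>. 1 - norm (y - z) * \<kappa>)"
      by (intro Bochner_Integration.integral_cong) (auto simp: ij[OF y])
    also have "\<dots> = 1 - (LINT z|\<sigma>. norm (y - z)) * \<kappa>"
    proof -
      have "norm (y - z) \<le> 2" if "z \<in> sphere 0 1" for z :: "real^'n"
        using y that norm_triangle_ineq4[of y z] by simp
      then have "integrable \<sigma> (\<lambda>z. norm (y - z))"
        by (intro integrable_normalized_surface_measure[where B = 2]) auto
      then show ?thesis by simp
    qed
    finally show ?thesis
      by (simp add: V_def integral_distance_sphere[OF y])
  qed
  \<comment> \<open>Averaging the second point as well changes nothing, because the value in
    \<open>iB\<close> is the same for every point of the sphere.\<close>
  have BB: "(LINT p|?Q. B p * B p) = 1 - V * \<kappa>"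
  proof -
    have "(LINT p|?Q. B p * B p) = (LINT z|\<sigma>. LINT p|?Q. B p * cap_ind z p)"
      by (subst (2) B_def, rule integral_cap_average) (auto simp: B_le)
    also have "\<dots> = 1 - V * \<kappa>"
      by (rule integral_const_normalized_surface_measure) (simp add: iB mult.commute[of "B _"])
    finally show ?thesis .
  qed
  define S2 where "S2 = (\<Sum>i=1..N. \<Sum>j=1..N. norm (x i - x j))"
  let ?A = "\<lambda>p. (\<Sum>i=1..N. cap_ind (x i) p) / real N - B p"
  have expand: "(?A p)\<^sup>2 = (\<Sum>i=1..N. \<Sum>j=1..N. cap_ind (x i) p * cap_ind (x j) p) / (real N)\<^sup>2
      - 2 * (\<Sum>i=1..N. cap_ind (x i) p * B p) / real N + B p * B p" for p
  proof -
    have "(\<Sum>i=1..N. \<Sum>j=1..N. cap_ind (x i) p * cap_ind (x j) p) = (\<Sum>i=1..N. cap_ind (x i) p)\<^sup>2"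
      by (simp only: power2_eq_square sum_product)
    moreover have "(\<Sum>i=1..N. cap_ind (x i) p * B p) = (\<Sum>i=1..N. cap_ind (x i) p) * B p"
      by (simp only: sum_distrib_right)
    ultimately show ?thesis
      by (simp only: power2_diff power_divide) (simp add: power2_eq_square)
  qed
  have int: "integrable ?Q (\<lambda>p. cap_ind (x i) p * cap_ind (x j) p)" "integrable ?Q (\<lambda>p. cap_ind (x i) p * B p)"
    "integrable ?Q (\<lambda>p. B p * B p)" for i j
    by (intro integrable borel_measurable_cap_ind abs_cap_ind_le B_meas B_le)+
  have "(LINT p|?Q. (?A p)\<^sup>2) = (\<Sum>i=1..N. \<Sum>j=1..N. LINT p|?Q. cap_ind (x i) p * cap_ind (x j) p) / (real N)\<^sup>2
      - 2 * (\<Sum>i=1..N. LINT p|?Q. cap_ind (x i) p * B p) / real N + (LINT p|?Q. B p * B p)"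
    unfolding expand by (simp add: int)
  also have "\<dots> = (\<Sum>i=1..N. \<Sum>j=1..N. 1 - norm (x i - x j) * \<kappa>) / (real N)\<^sup>2
      - 2 * (\<Sum>i=1..N. 1 - V * \<kappa>) / real N + (1 - V * \<kappa>)"
    using x by (simp add: ij iB BB)
  also have "(\<Sum>i=1..N. \<Sum>j=1..N. 1 - norm (x i - x j) * \<kappa>) = (real N)\<^sup>2 - S2 * \<kappa>"
    by (simp add: sum_subtractf S2_def power2_eq_square flip: sum_distrib_right)
  \<comment> \<open>The constants cancel as 1 - 2 + 1, and the terms \<open>V * \<kappa>\<close>
    combine as 2 - 1.\<close>
  also have "((real N)\<^sup>2 - S2 * \<kappa>) / (real N)\<^sup>2 - 2 * (\<Sum>i=1..N. 1 - V * \<kappa>) / real N + (1 - V * \<kappa>)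
      = \<kappa> * (V - S2 / (real N)\<^sup>2)"
    using \<open>N \<ge> 1\<close> by (simp add: field_simps power2_eq_square)
  finally have main: "(LINT p|?Q. (?A p)\<^sup>2) = \<kappa> * (V - S2 / (real N)\<^sup>2)" .
  have A_le: "\<bar>?A p\<bar> \<le> 2" for p
  proof -
    have "\<bar>\<Sum>i=1..N. cap_ind (x i) p\<bar> \<le> (\<Sum>i=1..N. 1)"
      by (rule sum_abs[THEN order_trans], rule sum_mono) (simp add: abs_cap_ind_le)
    then have "\<bar>(\<Sum>i=1..N. cap_ind (x i) p) / real N\<bar> \<le> 1"
      using \<open>N \<ge> 1\<close> by (simp add: divide_simps)
    with B_le[of p] show ?thesis by linarith
  qed
  have "integrable ?Q (\<lambda>p. (?A p)\<^sup>2)"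
    using power_mono[OF A_le abs_ge_zero, of _ 2]
    by (intro finite_measure.integrable_const_bound[OF finite_measure_cap_parameter, where B = 4]) auto
  then have "integrable (?I \<Otimes>\<^sub>M \<sigma>) (case_prod (\<lambda>t w. (?A (t, w))\<^sup>2))"
    by (simp add: cap_parameter_measure_def case_prod_unfold)
  \<comment> \<open>The product integral returns to the iterated order, over \<open>w\<close> inside
    and \<open>t\<close> outside, in which \<open>cap_discrepancy\<close> is defined.\<close>
  from P.integral_fst[OF this]
  have Q: "(LINT p|?Q. (?A p)\<^sup>2) = (LINT t|?I. LINT w|\<sigma>. (?A (t, w))\<^sup>2)"
    by (simp add: cap_parameter_measure_def case_prod_unfold)
  have "(LINT t:{-1<..<1}|lborel. LINT w|\<sigma>.
       \<bar>(1 / real N) * (\<Sum>i=1..N. indicator (spherical_cap w t) (x i)) - measure \<sigma> (spherical_cap w t)\<bar>\<^sup>2)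
    = (LINT t:{-1<..<1}|lborel. LINT w|\<sigma>. (?A (t, w))\<^sup>2)"
  proof (intro set_lebesgue_integral_cong ballI allI impI Bochner_Integration.integral_cong refl)
    fix t w assume "w \<in> space (\<sigma> :: (real^'n) measure)"
    have "(\<Sum>i=1..N. indicator (spherical_cap w t) (x i)) = (\<Sum>i=1..N. cap_ind (x i) (t, w))"
      using x by (intro sum.cong) (auto simp: indicator_spherical_cap)
    moreover have "B (t, w) = measure \<sigma> (spherical_cap w t)"
    proof -
      have "B (t, w) = (LINT y|\<sigma>. indicator (spherical_cap w t) y)"
        unfolding B_def
        by (intro Bochner_Integration.integral_cong) (auto simp: indicator_spherical_cap)
      also have "\<dots> = measure \<sigma> (spherical_cap w t \<inter> sphere 0 1)"
        by simp
      also have "spherical_cap w t \<inter> sphere 0 1 = spherical_cap w t"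
        by (auto simp: spherical_cap_def)
      finally show ?thesis .
    qed
    ultimately show "\<bar>(1 / real N) * (\<Sum>i=1..N. indicator (spherical_cap w t) (x i))
        - measure \<sigma> (spherical_cap w t)\<bar>\<^sup>2 = (?A (t, w))\<^sup>2"
      by simp
  qed auto
  also have "\<dots> = (LINT t|?I. LINT w|\<sigma>. (?A (t, w))\<^sup>2)"
    by (simp add: set_lebesgue_integral_def integral_restrict_space)
  also have "\<dots> = \<kappa> * (V - S2 / (real N)\<^sup>2)"
    using Q main by simp
  finally show ?thesis
    unfolding cap_discrepancy_def \<kappa>_def V_def S2_def by simp
qed

section \<open>The greedy condition and the discrepancy bound\<close>

text \<open>Adding the point with index \<open>n + 1\<close> increases the double sum by twice its
  distances to the earlier points, hence by at least \<open>2 * n * V\<close>. This matches the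
  increment \<open>2 * n\<close> of \<open>n\<^sup>2 - n\<close>.\<close>

lemma sum_distances_greedy:
  fixes x :: "nat \<Rightarrow> 'a::real_normed_vector"
  assumes greedy: "\<And>n. n \<ge> m \<Longrightarrow> (\<Sum>i=1..n. norm (x (n + 1) - x i)) \<ge> real n * V"
    and "m \<le> N"
  shows "(\<Sum>i=1..N. \<Sum>j=1..N. norm (x i - x j)) \<ge> V * ((real N)\<^sup>2 - real N - (real m)\<^sup>2 + real m)"
  using \<open>m \<le> N\<close>
proof (induction N rule: dec_induct)
  \<comment> \<open>At \<open>N = m\<close> the lower bound is zero, and distances are
    nonnegative.\<close>
  case base
  show ?case by (simp add: sum_nonneg)
next
  case (step n)
  have "(\<Sum>i=1..Suc n. \<Sum>j=1..Suc n. norm (x i - x j))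
      = (\<Sum>i=1..n. \<Sum>j=1..n. norm (x i - x j)) + 2 * (\<Sum>i=1..n. norm (x (n + 1) - x i))"
    by (simp add: sum.distrib norm_minus_commute[of "x (Suc n)"])
  moreover have "V * ((real (Suc n))\<^sup>2 - real (Suc n) - (real m)\<^sup>2 + real m)
      = V * ((real n)\<^sup>2 - real n - (real m)\<^sup>2 + real m) + 2 * (real n * V)"
    by (simp add: power2_eq_square algebra_simps)
  ultimately show ?case
    using step.IH greedy[OF step.hyps(1)] by linarith
qed

theorem theorem2p4:
  fixes x :: "nat \<Rightarrow> real^'n" and d m N :: nat
  assumes "d \<ge> 1" and "CARD('n) = d + 1" and "m \<ge> 1"
    and "\<And>n. n \<ge> 1 \<Longrightarrow> x n \<in> sphere 0 1"
    and "\<And>n. n \<ge> m \<Longrightarrow>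
           (\<Sum>i=1..n. norm (x (n + 1) - x i)) \<ge> real n * mean_distance TYPE('n)"
    and "N \<ge> m"
  shows "cap_discrepancy x N \<le>
           sqrt (1 / real d * (Gamma ((real d + 1) / 2) / (sqrt pi * Gamma (real d / 2))))
           * sqrt (mean_distance TYPE('n))
           * sqrt (1 / real N + ((real m)\<^sup>2 - real m) / (real N)\<^sup>2)
       \<and> (d = 2 \<longrightarrow>
           cap_discrepancy x N \<le>
             sqrt 2 / sqrt 3 * sqrt (1 / real N + ((real m)\<^sup>2 - real m) / (real N)\<^sup>2))"
proof -
  define \<kappa> where "\<kappa> = 1 / real d * (Gamma ((real d + 1) / 2) / (sqrt pi * Gamma (real d / 2)))"
  define V where "V = mean_distance TYPE('n)"
  define R where "R = 1 / real N + ((real m)\<^sup>2 - real m) / (real N)\<^sup>2"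
  define S2 where "S2 = (\<Sum>i=1..N. \<Sum>j=1..N. norm (x i - x j))"
  have "N \<ge> 1" using \<open>m \<ge> 1\<close> \<open>N \<ge> m\<close> by simp
  have "0 \<le> \<kappa>"
    using \<open>d \<ge> 1\<close> by (auto simp: \<kappa>_def intro!: mult_nonneg_nonneg divide_nonneg_nonneg less_imp_le[OF Gamma_real_pos])
  have "real m \<le> (real m)\<^sup>2"
    using \<open>m \<ge> 1\<close> by (simp add: power2_eq_square)
  then have "0 \<le> R"
    by (simp add: R_def)
  have "unit_ball_vol (real (CARD('n) - 1)) / (real CARD('n) * unit_ball_vol (real CARD('n))) = \<kappa>"
    using unit_ball_vol_ratio_Gamma[OF \<open>d \<ge> 1\<close>] assms(2) by (simp add: \<kappa>_def)
  then have D: "cap_discrepancy x N = sqrt (\<kappa> * (V - S2 / (real N)\<^sup>2))"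
    using stolarsky_invariance[of x N] assms(4) \<open>N \<ge> 1\<close> by (simp add: V_def S2_def)
  have "V * ((real N)\<^sup>2 - real N - (real m)\<^sup>2 + real m) \<le> S2"
    unfolding S2_def V_def by (rule sum_distances_greedy[OF assms(5) \<open>N \<ge> m\<close>])
  then have "V * ((real N)\<^sup>2 - real N - (real m)\<^sup>2 + real m) / (real N)\<^sup>2 \<le> S2 / (real N)\<^sup>2"
    by (rule divide_right_mono) simp
  \<comment> \<open>The part of \<open>N\<^sup>2\<close> that the greedy bound misses is
    \<open>N + m\<^sup>2 - m\<close>; divided by \<open>N\<^sup>2\<close> it is
    \<open>R\<close>.\<close>
  moreover have "V - V * ((real N)\<^sup>2 - real N - (real m)\<^sup>2 + real m) / (real N)\<^sup>2 = V * R"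
    using \<open>N \<ge> 1\<close> by (simp add: R_def field_simps power2_eq_square)
  ultimately have "V - S2 / (real N)\<^sup>2 \<le> V * R"
    by linarith
  with \<open>0 \<le> \<kappa>\<close> have le: "cap_discrepancy x N \<le> sqrt (\<kappa> * (V * R))"
    unfolding D by (intro real_sqrt_le_mono mult_left_mono)
  then have 1: "cap_discrepancy x N \<le> sqrt \<kappa> * sqrt V * sqrt R"
    by (simp add: real_sqrt_mult)
  have 2: "cap_discrepancy x N \<le> sqrt 2 / sqrt 3 * sqrt R" if "d = 2"
  proof -
    \<comment> \<open>Here \<open>Gamma (3 / 2) = sqrt pi / 2\<close> and
      \<open>Gamma 1 = 1\<close>, so the Gamma quotient is 1/2, halved again by
      \<open>1 / d\<close>.\<close>
    have "\<kappa> = 1 / 4"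
    proof -
      have "(1 / 2 :: real) \<notin> \<int>\<^sub>\<le>\<^sub>0"
        using nonpos_Ints_nonpos[of "1 / 2 :: real"] by auto
      from Gamma_plus1[OF this] that show ?thesis
        by (simp add: \<kappa>_def Gamma_one_half_real)
    qed
    have "V * R \<le> 2 * R"
      using mean_distance_le[where 'n='n] \<open>0 \<le> R\<close> by (intro mult_right_mono) (simp_all add: V_def)
    then have "\<kappa> * (V * R) \<le> 1 / 4 * (2 * R)"
      using \<open>\<kappa> = 1 / 4\<close> by (metis mult_left_mono zero_le_divide_1_iff zero_le_numeral)
    \<comment> \<open>The diameter bound \<open>V \<le> 2\<close> yields the constant 1/2, which
      already lies below 2/3, the square of \<open>sqrt 2 / sqrt 3\<close>.\<close>
    also have "\<dots> \<le> 2 / 3 * R"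
      using \<open>0 \<le> R\<close> by simp
    finally have "sqrt (\<kappa> * (V * R)) \<le> sqrt (2 / 3 * R)"
      by (rule real_sqrt_le_mono)
    with le show ?thesis
      by (simp add: real_sqrt_mult real_sqrt_divide)
  qed
  show ?thesis
    using 1 2 unfolding \<kappa>_def V_def R_def by blast
qed

end
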